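(* Let $(X,\mathcal A,m)$ and $(\Omega,\mathcal F,\mathbb P)$ be probability spaces and let $\sigma:\Omega\to\Omega$ be an invertible, $\mathbb P$-preserving, mixing transformation. Let $(\omega,x)\mapsto T_\omega x$ be a measurable map $\Omega\times X\to X$ such that $T_\omega:X\to X$ is non-singular with respect to $m$ for $\mathbb P$-almost every $\omega$, and let $(P,\sigma)$ be the Markov operator cocycle for which $P_\omega$ is the Perron–Frobenius operator of $T_\omega$ for $\mathbb P$-almost every $\omega$. Assume that there is an invariant density map $h:\Omega\to D(X,m)$ of $(P,\sigma)$ and put $\mu_\omega(A)=\int_A h_\omega\,dm$ for $A\in\mathcal A$. Let $\Theta:\Omega\times X\to\Omega\times X$, $\Theta(\omega,x)=(\sigma\omega,T_\omega x)$, and let $\nu$ be the probability measure on $(\Omega\times X,\mathcal F\otimes\mathcal A)$ given by $\nu(A)=\int_\Omega\mu_\omega(A_\omega)\,d\mathbb P(\omega)$, where $A_\omega=\{x\in X:(\omega,x)\in A\}$. If $(P,\sigma)$ is prior mixing for inhomogeneous observables in $B(\Omega,L^\infty(X,m))$, then $\Theta$ is mixing, that is, for all $A,B\in\mathcal F\otimes\mathcal A$, $$\lim_{n\to\infty}\nu(\Theta^{-n}A\cap B)=\nu(A)\nu(B).$$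
   Context: $D(X,m)=\{f\in L^1(X,m): f\ge 0\ m\text{-a.e.},\ \|f\|_{L^1(X)}=1\}$ and $L^1_0(X,m)=\{f\in L^1(X,m):\int_X f\,dm=0\}$. The Perron–Frobenius operator $L_T$ of a non-singular map $T$ ($T_*m\ll m$) is characterized by $\int_X L_Tf\cdot g\,dm=\int_X f\cdot g\circ T\,dm$ for $f\in L^1(X,m)$, $g\in L^\infty(X,m)$. A Markov operator on $L^1(X,m)$ is a linear positive operator preserving the integral $\int_X\cdot\,dm$. A Markov operator cocycle $(P,\sigma)$ is given by a measurable map $P:\Omega\times L^1(X,m)\to L^1(X,m)$ such that $P_\omega=P(\omega,\cdot)$ is a Markov operator for $\mathbb P$-almost every $\omega$; set $P^{(n)}_\omega=P_{\sigma^{n-1}\omega}\circ\cdots\circ P_{\sigma\omega}\circ P_\omega$. An invariant density map for $(P,\sigma)$ is a measurable map $h:\Omega\to D(X,m)$, $\omega\mapsto h_\omega$, with $P_\omega h_\omega=h_{\sigma\omega}$ for $\mathbb P$-almost every $\omega$. $B(\Omega,L^\infty(X,m))$ is the set of all bounded measurable maps $g:\Omega\to L^\infty(X,m)$, $\omega\mapsto g_\omega$. Prior mixing for inhomogeneous observables in $B(\Omega,L^\infty(X,m))$: for $\mathbb P$-almost every $\omega$, for all $f\in L^1_0(X,m)$ and all $g\in B(\Omega,L^\infty(X,m))$, $\lim_{n\to\infty}\int_X P^{(n)}_\omega f\cdot g_{\sigma^n\omega}\,dm=0$ (the full-measure set of $\omega$ does not depend on $f,g$). *)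

theory Defs
  imports "HOL-Probability.Probability" "HOL-Probability.Essential_Supremum"
begin

section \<open>Lebesgue spaces and their Borel structures\<close>

text \<open>
  Elements of the spaces \<open>L\<^sup>1\<close> and \<open>L\<^sup>\<infinity>\<close> are given by representatives, that is, by
  functions on the underlying space, and equality of elements is rendered as equality almost
  everywhere.  The Borel \<open>\<sigma>\<close>-algebra of such a space is generated by the sets of
  representatives that are open for the (semi)norm.  These sets are saturated for almost
  everywhere equality, so this is the inverse image of the Borel \<open>\<sigma>\<close>-algebra of the normed
  space of equivalence classes.
\<close>

definition seminorm_borel :: "('x \<Rightarrow> real) set \<Rightarrow> (('x \<Rightarrow> real) \<Rightarrow> real) \<Rightarrow> ('x \<Rightarrow> real) measure" where
  "seminorm_borel V N = sigma V
     {U. U \<subseteq> V \<and> (\<forall>f\<in>U. \<exists>e>0. \<forall>g\<in>V. N (\<lambda>x. g x - f x) < e \<longrightarrow> g \<in> U)}"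

definition L1 :: "'x measure \<Rightarrow> ('x \<Rightarrow> real) set" where
  "L1 m = {f. integrable m f}"

definition L1_norm :: "'x measure \<Rightarrow> ('x \<Rightarrow> real) \<Rightarrow> real" where
  "L1_norm m f = (\<integral>x. \<bar>f x\<bar> \<partial>m)"

definition L1_borel :: "'x measure \<Rightarrow> ('x \<Rightarrow> real) measure" where
  "L1_borel m = seminorm_borel (L1 m) (L1_norm m)"

definition Linf :: "'x measure \<Rightarrow> ('x \<Rightarrow> real) set" where
  "Linf m = {g. g \<in> borel_measurable m \<and> esssup m (\<lambda>x. ereal \<bar>g x\<bar>) < \<infinity>}"

definition Linf_norm :: "'x measure \<Rightarrow> ('x \<Rightarrow> real) \<Rightarrow> real" where
  "Linf_norm m g = real_of_ereal (esssup m (\<lambda>x. ereal \<bar>g x\<bar>))"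

definition Linf_borel :: "'x measure \<Rightarrow> ('x \<Rightarrow> real) measure" where
  "Linf_borel m = seminorm_borel (Linf m) (Linf_norm m)"

definition densities :: "'x measure \<Rightarrow> ('x \<Rightarrow> real) set" where
  "densities m = {f \<in> L1 m. (AE x in m. 0 \<le> f x) \<and> L1_norm m f = 1}"

definition L1_zero :: "'x measure \<Rightarrow> ('x \<Rightarrow> real) set" where
  "L1_zero m = {f \<in> L1 m. (\<integral>x. f x \<partial>m) = 0}"

definition bounded_Linf_maps :: "'w measure \<Rightarrow> 'x measure \<Rightarrow> ('w \<Rightarrow> 'x \<Rightarrow> real) set" where
  "bounded_Linf_maps \<P> m =
     {g. g \<in> \<P> \<rightarrow>\<^sub>M Linf_borel m \<and> (\<exists>C. \<forall>\<omega>\<in>space \<P>. Linf_norm m (g \<omega>) \<le> C)}"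


section \<open>Transformations\<close>

definition measure_preserving :: "'w measure \<Rightarrow> ('w \<Rightarrow> 'w) \<Rightarrow> bool" where
  "measure_preserving M T \<longleftrightarrow> T \<in> M \<rightarrow>\<^sub>M M \<and> distr M M T = M"

definition invertible_transformation :: "'w measure \<Rightarrow> ('w \<Rightarrow> 'w) \<Rightarrow> bool" where
  "invertible_transformation M T \<longleftrightarrow>
     T \<in> M \<rightarrow>\<^sub>M M \<and> bij_betw T (space M) (space M) \<and> the_inv_into (space M) T \<in> M \<rightarrow>\<^sub>M M"

definition mixing :: "'w measure \<Rightarrow> ('w \<Rightarrow> 'w) \<Rightarrow> bool" where
  "mixing M T \<longleftrightarrow> (\<forall>A\<in>sets M. \<forall>B\<in>sets M.
     (\<lambda>n. measure M (((T ^^ n) -` A \<inter> space M) \<inter> B)) \<longlonglongrightarrow> measure M A * measure M B)"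

definition nonsingular :: "'x measure \<Rightarrow> ('x \<Rightarrow> 'x) \<Rightarrow> bool" where
  "nonsingular m T \<longleftrightarrow> T \<in> m \<rightarrow>\<^sub>M m \<and> absolutely_continuous m (distr m m T)"

definition skew_product :: "('w \<Rightarrow> 'w) \<Rightarrow> ('w \<Rightarrow> 'x \<Rightarrow> 'x) \<Rightarrow> 'w \<times> 'x \<Rightarrow> 'w \<times> 'x" where
  "skew_product \<sigma> T = (\<lambda>(\<omega>, x). (\<sigma> \<omega>, T \<omega> x))"


section \<open>Markov operators and their cocycles\<close>

definition perron_frobenius_operator ::
    "'x measure \<Rightarrow> ('x \<Rightarrow> 'x) \<Rightarrow> (('x \<Rightarrow> real) \<Rightarrow> 'x \<Rightarrow> real) \<Rightarrow> bool" where
  "perron_frobenius_operator m T L \<longleftrightarrow>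
     (\<forall>f\<in>L1 m. L f \<in> L1 m \<and>
        (\<forall>g\<in>Linf m. (\<integral>x. L f x * g x \<partial>m) = (\<integral>x. f x * g (T x) \<partial>m)))"

text \<open>
  Linearity and positivity together imply that a Markov operator respects almost everywhere
  equality, so it is an operator on equivalence classes.
\<close>

definition markov_operator :: "'x measure \<Rightarrow> (('x \<Rightarrow> real) \<Rightarrow> 'x \<Rightarrow> real) \<Rightarrow> bool" where
  "markov_operator m L \<longleftrightarrow>
     (\<forall>f\<in>L1 m. L f \<in> L1 m) \<and>
     (\<forall>f\<in>L1 m. \<forall>g\<in>L1 m. \<forall>a b. AE x in m. L (\<lambda>y. a * f y + b * g y) x = a * L f x + b * L g x) \<and>
     (\<forall>f\<in>L1 m. (AE x in m. 0 \<le> f x) \<longrightarrow> (AE x in m. 0 \<le> L f x)) \<and>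
     (\<forall>f\<in>L1 m. (\<integral>x. L f x \<partial>m) = (\<integral>x. f x \<partial>m))"

definition markov_operator_cocycle ::
    "'w measure \<Rightarrow> 'x measure \<Rightarrow> ('w \<Rightarrow> ('x \<Rightarrow> real) \<Rightarrow> 'x \<Rightarrow> real) \<Rightarrow> bool" where
  "markov_operator_cocycle \<P> m P \<longleftrightarrow>
     (\<lambda>(\<omega>, f). P \<omega> f) \<in> \<P> \<Otimes>\<^sub>M L1_borel m \<rightarrow>\<^sub>M L1_borel m \<and>
     (AE \<omega> in \<P>. markov_operator m (P \<omega>))"

fun cocycle_iterate ::
    "('w \<Rightarrow> ('x \<Rightarrow> real) \<Rightarrow> 'x \<Rightarrow> real) \<Rightarrow> ('w \<Rightarrow> 'w) \<Rightarrow> nat \<Rightarrow> 'w \<Rightarrow> ('x \<Rightarrow> real) \<Rightarrow> 'x \<Rightarrow> real" where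
  "cocycle_iterate P \<sigma> 0 \<omega> = id"
| "cocycle_iterate P \<sigma> (Suc n) \<omega> = P ((\<sigma> ^^ n) \<omega>) \<circ> cocycle_iterate P \<sigma> n \<omega>"

definition invariant_density_map ::
    "'w measure \<Rightarrow> 'x measure \<Rightarrow> ('w \<Rightarrow> ('x \<Rightarrow> real) \<Rightarrow> 'x \<Rightarrow> real) \<Rightarrow> ('w \<Rightarrow> 'w) \<Rightarrow>
     ('w \<Rightarrow> 'x \<Rightarrow> real) \<Rightarrow> bool" where
  "invariant_density_map \<P> m P \<sigma> h \<longleftrightarrow>
     h \<in> \<P> \<rightarrow>\<^sub>M restrict_space (L1_borel m) (densities m) \<and>
     (AE \<omega> in \<P>. AE x in m. P \<omega> (h \<omega>) x = h (\<sigma> \<omega>) x)"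

definition prior_mixing_inhomogeneous ::
    "'w measure \<Rightarrow> 'x measure \<Rightarrow> ('w \<Rightarrow> ('x \<Rightarrow> real) \<Rightarrow> 'x \<Rightarrow> real) \<Rightarrow> ('w \<Rightarrow> 'w) \<Rightarrow> bool" where
  "prior_mixing_inhomogeneous \<P> m P \<sigma> \<longleftrightarrow>
     (AE \<omega> in \<P>. \<forall>f\<in>L1_zero m. \<forall>g\<in>bounded_Linf_maps \<P> m.
        (\<lambda>n. \<integral>x. cocycle_iterate P \<sigma> n \<omega> f x * g ((\<sigma> ^^ n) \<omega>) x \<partial>m) \<longlonglongrightarrow> 0)"


section \<open>The measure on the total space\<close>

definition fibre_measure :: "'x measure \<Rightarrow> ('w \<Rightarrow> 'x \<Rightarrow> real) \<Rightarrow> 'w \<Rightarrow> 'x set \<Rightarrow> real" where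
  "fibre_measure m h \<omega> A = (LINT x:A|m. h \<omega> x)"

definition skew_measure :: "'w measure \<Rightarrow> 'x measure \<Rightarrow> ('w \<Rightarrow> 'x \<Rightarrow> real) \<Rightarrow> ('w \<times> 'x) measure" where
  "skew_measure \<P> m h =
     measure_of (space (\<P> \<Otimes>\<^sub>M m)) (sets (\<P> \<Otimes>\<^sub>M m))
       (\<lambda>A. \<integral>\<^sup>+\<omega>. ennreal (fibre_measure m h \<omega> {x\<in>space m. (\<omega>, x) \<in> A}) \<partial>\<P>)"

text \<open>
  The constant \<^const>\<open>measure_of\<close> yields the zero measure when its argument is not countably
  additive; the following facts show that this does not happen for measurable density maps.
\<close>

lemma space_L1_borel: "space (L1_borel m) = L1 m"
  unfolding L1_borel_def seminorm_borel_def by (rule space_measure_of) auto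

lemma L1_borel_openI:
  assumes "U \<subseteq> L1 m"
    and "\<And>f. f \<in> U \<Longrightarrow> \<exists>e>0. \<forall>g\<in>L1 m. L1_norm m (\<lambda>x. g x - f x) < e \<longrightarrow> g \<in> U"
  shows "U \<in> sets (L1_borel m)"
  unfolding L1_borel_def seminorm_borel_def
  using assms by (subst sets_measure_of) (auto intro!: sigma_sets.Basic)

lemma set_integral_measurable_L1_borel:
  assumes E: "E \<in> sets m"
  shows "(\<lambda>f. LINT x:E|m. f x) \<in> borel_measurable (L1_borel m)"
proof (rule borel_measurableI)
  fix S :: "real set" assume S: "open S"
  show "(\<lambda>f. LINT x:E|m. f x) -` S \<inter> space (L1_borel m) \<in> sets (L1_borel m)"
  proof (rule L1_borel_openI)
    fix f assume f: "f \<in> (\<lambda>f. LINT x:E|m. f x) -` S \<inter> space (L1_borel m)"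
    then have fi: "integrable m f" by (simp add: space_L1_borel L1_def)
    from f S obtain e where e: "e > 0" "\<And>y. dist y (LINT x:E|m. f x) < e \<Longrightarrow> y \<in> S"
      by (auto simp: open_dist)
    have "g \<in> (\<lambda>f. LINT x:E|m. f x) -` S \<inter> space (L1_borel m)"
      if g: "g \<in> L1 m" and n: "L1_norm m (\<lambda>x. g x - f x) < e" for g
    proof -
      have gi: "integrable m g" using g by (simp add: L1_def)
      have si: "set_integrable m E g" "set_integrable m E f"
        unfolding set_integrable_def using integrable_mult_indicator[OF E gi] integrable_mult_indicator[OF E fi] by blast+
      have "\<bar>(LINT x:E|m. g x) - (LINT x:E|m. f x)\<bar> = \<bar>LINT x:E|m. g x - f x\<bar>"
        using si by (simp add: set_integral_diff)
      also have "\<dots> \<le> (\<integral>x. \<bar>indicator E x *\<^sub>R (g x - f x)\<bar> \<partial>m)"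
        unfolding set_lebesgue_integral_def by (rule integral_abs_bound)
      also have "\<dots> \<le> (\<integral>x. \<bar>g x - f x\<bar> \<partial>m)"
        using fi gi E by (intro integral_mono integrable_abs integrable_mult_indicator)
          (auto simp: indicator_def)
      finally have "dist (LINT x:E|m. g x) (LINT x:E|m. f x) < e"
        using n by (simp add: L1_norm_def dist_real_def)
      then show ?thesis using e g by (simp add: space_L1_borel)
    qed
    then show "\<exists>e>0. \<forall>g\<in>L1 m. L1_norm m (\<lambda>x. g x - f x) < e \<longrightarrow>
        g \<in> (\<lambda>f. LINT x:E|m. f x) -` S \<inter> space (L1_borel m)"
      using e(1) by blast
  qed (auto simp: space_L1_borel)
qed

context
  fixes \<P> :: "'w measure" and m :: "'x measure" and h :: "'w \<Rightarrow> 'x \<Rightarrow> real"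
  assumes prob_base: "prob_space \<P>" and prob_fibre: "prob_space m"
    and h: "h \<in> \<P> \<rightarrow>\<^sub>M restrict_space (L1_borel m) (densities m)"
begin

lemma density_map_in_densities: "\<omega> \<in> space \<P> \<Longrightarrow> h \<omega> \<in> densities m"
  using measurable_space[OF h] by (auto simp: space_restrict_space)

lemma emeasure_density_map:
  assumes "\<omega> \<in> space \<P>" and E: "E \<in> sets m"
  shows "emeasure (density m (\<lambda>x. ennreal (h \<omega> x))) E = ennreal (fibre_measure m h \<omega> E)"
proof -
  have i: "integrable m (h \<omega>)" and p: "AE x in m. 0 \<le> h \<omega> x"
    using density_map_in_densities[OF assms(1)] by (auto simp: densities_def L1_def)
  have "emeasure (density m (\<lambda>x. ennreal (h \<omega> x))) E =
      (\<integral>\<^sup>+x. ennreal (h \<omega> x) * indicator E x \<partial>m)"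
    using i E by (intro emeasure_density) auto
  also have "\<dots> = (\<integral>\<^sup>+x. ennreal (indicator E x *\<^sub>R h \<omega> x) \<partial>m)"
    by (intro nn_integral_cong) (auto simp: indicator_def)
  also have "\<dots> = ennreal (\<integral>x. indicator E x *\<^sub>R h \<omega> x \<partial>m)"
    using i E p by (intro nn_integral_eq_integral integrable_mult_indicator)
      (auto elim!: eventually_mono)
  finally show ?thesis by (simp add: fibre_measure_def set_lebesgue_integral_def)
qed

lemma fibre_measure_space: "\<omega> \<in> space \<P> \<Longrightarrow> fibre_measure m h \<omega> (space m) = 1"
proof -
  assume "\<omega> \<in> space \<P>"
  then have d: "integrable m (h \<omega>)" "AE x in m. 0 \<le> h \<omega> x" "(\<integral>x. \<bar>h \<omega> x\<bar> \<partial>m) = 1"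
    using density_map_in_densities by (auto simp: densities_def L1_def L1_norm_def)
  have "fibre_measure m h \<omega> (space m) = (\<integral>x. h \<omega> x \<partial>m)"
    using d(1) by (simp add: fibre_measure_def set_integral_space)
  also have "\<dots> = (\<integral>x. \<bar>h \<omega> x\<bar> \<partial>m)"
    using d(1,2) by (intro integral_cong_AE) auto
  finally show ?thesis using d(3) by simp
qed

lemma density_map_kernel:
  "(\<lambda>\<omega>. density m (\<lambda>x. ennreal (h \<omega> x))) \<in> \<P> \<rightarrow>\<^sub>M subprob_algebra m"
proof (rule measurable_subprob_algebra)
  fix \<omega> assume w: "\<omega> \<in> space \<P>"
  show "subprob_space (density m (\<lambda>x. ennreal (h \<omega> x)))"
    using emeasure_density_map[OF w sets.top] fibre_measure_space[OF w]
      prob_space.not_empty[OF prob_fibre]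
    by (intro subprob_spaceI) auto
  show "sets (density m (\<lambda>x. ennreal (h \<omega> x))) = sets m" by simp
next
  fix E assume E: "E \<in> sets m"
  have "h \<in> \<P> \<rightarrow>\<^sub>M L1_borel m"
    using h by (simp add: measurable_restrict_space2_iff)
  then have "(\<lambda>\<omega>. LINT x:E|m. h \<omega> x) \<in> borel_measurable \<P>"
    using measurable_compose[OF _ set_integral_measurable_L1_borel[OF E]] by blast
  then have "(\<lambda>\<omega>. ennreal (fibre_measure m h \<omega> E)) \<in> borel_measurable \<P>"
    unfolding fibre_measure_def by measurable
  then show "(\<lambda>\<omega>. emeasure (density m (\<lambda>x. ennreal (h \<omega> x))) E) \<in> borel_measurable \<P>"
    using emeasure_density_map[OF _ E] by (simp cong: measurable_cong)
qed

lemma section_sets: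
  assumes "A \<in> sets (\<P> \<Otimes>\<^sub>M m)" "\<omega> \<in> space \<P>"
  shows "{x\<in>space m. (\<omega>, x) \<in> A} \<in> sets m"
  using assms by measurable

lemma fibre_measure_measurable:
  assumes A: "A \<in> sets (\<P> \<Otimes>\<^sub>M m)"
  shows "(\<lambda>\<omega>. ennreal (fibre_measure m h \<omega> {x\<in>space m. (\<omega>, x) \<in> A})) \<in> borel_measurable \<P>"
proof -
  have "(SIGMA \<omega>:space \<P>. {x\<in>space m. (\<omega>, x) \<in> A}) = A"
    using sets.sets_into_space[OF A] by (auto simp: space_pair_measure)
  then have "(\<lambda>\<omega>. emeasure (density m (\<lambda>x. ennreal (h \<omega> x))) {x\<in>space m. (\<omega>, x) \<in> A})
      \<in> borel_measurable \<P>"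
    using A by (intro emeasure_measurable_subprob_algebra2[OF _ density_map_kernel]) simp
  then show ?thesis
    using emeasure_density_map[OF _ section_sets[OF A]] by (simp cong: measurable_cong)
qed

lemma sets_skew_measure: "sets (skew_measure \<P> m h) = sets (\<P> \<Otimes>\<^sub>M m)"
  unfolding skew_measure_def by (simp add: sets.sets_measure_of_eq)

lemma space_skew_measure: "space (skew_measure \<P> m h) = space (\<P> \<Otimes>\<^sub>M m)"
  using sets_skew_measure by (rule sets_eq_imp_space_eq)

lemma emeasure_skew_measure:
  assumes A: "A \<in> sets (\<P> \<Otimes>\<^sub>M m)"
  shows "emeasure (skew_measure \<P> m h) A =
    (\<integral>\<^sup>+\<omega>. ennreal (fibre_measure m h \<omega> {x\<in>space m. (\<omega>, x) \<in> A}) \<partial>\<P>)"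
proof (rule emeasure_measure_of[OF skew_measure_def])
  let ?\<nu> = "\<lambda>A. \<integral>\<^sup>+\<omega>. ennreal (fibre_measure m h \<omega> {x\<in>space m. (\<omega>, x) \<in> A}) \<partial>\<P>"
  show "sets (\<P> \<Otimes>\<^sub>M m) \<subseteq> Pow (space (\<P> \<Otimes>\<^sub>M m))"
    by (rule sets.space_closed)
  show "A \<in> sets (skew_measure \<P> m h)"
    using A by (simp add: sets_skew_measure)
  show "positive (sets (skew_measure \<P> m h)) ?\<nu>"
    by (simp add: positive_def fibre_measure_def set_lebesgue_integral_def)
  show "countably_additive (sets (skew_measure \<P> m h)) ?\<nu>"
    unfolding sets_skew_measure
  proof (rule countably_additiveI)
    fix F :: "nat \<Rightarrow> ('w \<times> 'x) set"
    assume F: "range F \<subseteq> sets (\<P> \<Otimes>\<^sub>M m)" and dj: "disjoint_family F"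
    then have Fi: "F i \<in> sets (\<P> \<Otimes>\<^sub>M m)" for i by auto
    have "(\<Sum>i. ?\<nu> (F i)) =
        (\<integral>\<^sup>+\<omega>. (\<Sum>i. ennreal (fibre_measure m h \<omega> {x\<in>space m. (\<omega>, x) \<in> F i})) \<partial>\<P>)"
      by (rule nn_integral_suminf[symmetric]) (rule fibre_measure_measurable[OF Fi])
    also have "\<dots> = ?\<nu> (\<Union>i. F i)"
    proof (rule nn_integral_cong)
      fix \<omega> assume w: "\<omega> \<in> space \<P>"
      let ?S = "\<lambda>i. {x\<in>space m. (\<omega>, x) \<in> F i}"
      have S: "?S i \<in> sets m" for i using section_sets[OF Fi w] .
      have U: "(\<Union>i. ?S i) = {x\<in>space m. (\<omega>, x) \<in> (\<Union>i. F i)}" by auto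
      have "(\<Sum>i. emeasure (density m (\<lambda>x. ennreal (h \<omega> x))) (?S i)) =
          emeasure (density m (\<lambda>x. ennreal (h \<omega> x))) (\<Union>i. ?S i)"
        using S dj by (intro suminf_emeasure) (auto simp: disjoint_family_on_def)
      moreover have "(\<Union>i. ?S i) \<in> sets m" using S by auto
      ultimately show "(\<Sum>i. ennreal (fibre_measure m h \<omega> (?S i))) =
          ennreal (fibre_measure m h \<omega> {x\<in>space m. (\<omega>, x) \<in> (\<Union>i. F i)})"
        using S by (simp add: emeasure_density_map[OF w] U)
    qed
    finally show "(\<Sum>i. ?\<nu> (F i)) = ?\<nu> (\<Union>i. F i)" .
  qed
qed

lemma prob_space_skew_measure: "prob_space (skew_measure \<P> m h)"
proof
  interpret base: prob_space \<P> by (rule prob_base)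
  have "{x\<in>space m. (\<omega>, x) \<in> space (\<P> \<Otimes>\<^sub>M m)} = space m" if "\<omega> \<in> space \<P>" for \<omega>
    using that by (auto simp: space_pair_measure)
  then have "emeasure (skew_measure \<P> m h) (space (\<P> \<Otimes>\<^sub>M m)) = (\<integral>\<^sup>+\<omega>. 1 \<partial>\<P>)"
    unfolding emeasure_skew_measure[OF sets.top]
    by (intro nn_integral_cong) (simp add: fibre_measure_space)
  then show "emeasure (skew_measure \<P> m h) (space (skew_measure \<P> m h)) = 1"
    by (simp add: space_skew_measure base.emeasure_space_1)
qed

end

end

theory Submission
  imports Defs
begin

text \<open>
  Since the skew product preserves \<open>\<nu>\<close>, the sets \<open>A\<close> for which
  \<open>\<nu>(\<Theta>\<^bsup>-n\<^esup> A \<inter> B) \<longrightarrow> \<nu>(A) \<nu>(B)\<close> holds for all \<open>B\<close> form a Dynkin system, so it suffices to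
  consider rectangles \<open>A = F \<times> E\<close>.  For these, prior mixing shows that on almost every fibre the
  difference between \<open>\<mu>\<^sub>\<omega>({x. T\<^sub>\<omega>\<^sup>n x \<in> E} \<inter> B\<^sub>\<omega>)\<close> and \<open>\<mu>\<^bsub>\<sigma>^n \<omega>\<^esub>(E) \<mu>\<^sub>\<omega>(B\<^sub>\<omega>)\<close> tends to zero, and
  mixing of the base gives the limit of the integral of \<open>1\<^sub>F(\<sigma>\<^sup>n\<omega>) \<mu>\<^bsub>\<sigma>^n \<omega>\<^esub>(E) \<mu>\<^sub>\<omega>(B\<^sub>\<omega>)\<close>.
  The reduction to rectangles is essential: for a general measurable \<open>A\<close> the map
  sending \<open>\<omega>\<close> to the indicator of \<open>A\<^sub>\<omega>\<close> need not be Borel measurable into the non-separable space \<open>L\<^sup>\<infinity>\<close>.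
\<close>

section \<open>Mixing transformations\<close>

text \<open>An e/3 argument: the error \<open>c i\<close> does not depend on \<open>n\<close>, so
  one fixed approximant controls all late terms of \<open>b\<close>. This closes the limit case of
  the two inductions over integrable functions below.\<close>

lemma tendsto_uniform_approximation:
  fixes a :: "nat \<Rightarrow> nat \<Rightarrow> real"
  assumes a: "\<And>i. a i \<longlonglongrightarrow> L i" and L: "L \<longlonglongrightarrow> l"
    and ab: "\<And>i n. \<bar>a i n - b n\<bar> \<le> c i" and c: "c \<longlonglongrightarrow> 0"
  shows "b \<longlonglongrightarrow> l"
proof (rule LIMSEQ_I)
  fix e :: real assume e: "e > 0"
  have "\<forall>\<^sub>F i in sequentially. c i < e / 3"
    using order_tendstoD(2)[OF c, of "e / 3"] e by simp
  moreover have "\<forall>\<^sub>F i in sequentially. dist (L i) l < e / 3"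
    using tendstoD[OF L, of "e / 3"] e by simp
  ultimately have "\<forall>\<^sub>F i in sequentially. c i < e / 3 \<and> dist (L i) l < e / 3"
    by (rule eventually_conj)
  then obtain i where i: "c i < e / 3" "dist (L i) l < e / 3"
    by (auto simp: eventually_sequentially)
  have "\<forall>\<^sub>F n in sequentially. dist (a i n) (L i) < e / 3"
    using tendstoD[OF a, of "e / 3"] e by simp
  then obtain N where N: "\<And>n. n \<ge> N \<Longrightarrow> dist (a i n) (L i) < e / 3"
    by (auto simp: eventually_sequentially)
  have "norm (b n - l) < e" if "n \<ge> N" for n
    using N[OF that] i ab[of i n] unfolding dist_real_def real_norm_def by linarith
  then show "\<exists>N. \<forall>n\<ge>N. norm (b n - l) < e" by blast
qed

text \<open>The hypotheses are what the limit case of \<open>integrable_induct\<close> supplies. The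
  factor 2 in the bound gives the dominating function \<open>3 * \<bar>f x\<bar>\<close> by the
  triangle inequality.\<close>

lemma integral_abs_diff_tendsto_0:
  fixes s :: "nat \<Rightarrow> 'a \<Rightarrow> real"
  assumes s: "\<And>i. integrable M (s i)" and f: "integrable M f"
    and lim: "\<And>x. x \<in> space M \<Longrightarrow> (\<lambda>i. s i x) \<longlonglongrightarrow> f x"
    and bound: "\<And>i x. x \<in> space M \<Longrightarrow> norm (s i x) \<le> 2 * norm (f x)"
  shows "(\<lambda>i. \<integral>x. \<bar>s i x - f x\<bar> \<partial>M) \<longlonglongrightarrow> 0"
proof -
  have "(\<lambda>i. \<integral>x. \<bar>s i x - f x\<bar> \<partial>M) \<longlonglongrightarrow> (\<integral>x. 0 \<partial>M)"
  proof (rule integral_dominated_convergence)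
    show "integrable M (\<lambda>x. 3 * \<bar>f x\<bar>)" using f by simp
    show "AE x in M. (\<lambda>i. \<bar>s i x - f x\<bar>) \<longlonglongrightarrow> 0"
    proof (rule AE_I2)
      fix x assume "x \<in> space M"
      then have "(\<lambda>i. \<bar>s i x - f x\<bar>) \<longlonglongrightarrow> \<bar>f x - f x\<bar>"
        by (intro tendsto_intros lim)
      then show "(\<lambda>i. \<bar>s i x - f x\<bar>) \<longlonglongrightarrow> 0" by simp
    qed
    show "AE x in M. norm \<bar>s i x - f x\<bar> \<le> 3 * \<bar>f x\<bar>" for i
      using bound[of _ i] by (intro AE_I2) (fastforce simp: abs_if split: if_splits)
  qed (use s f in auto)
  then show ?thesis by simp
qed

section \<open>Iterates of measure-preserving maps\<close>

lemma measure_preserving_funpow: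
  assumes "measure_preserving M S"
  shows "measure_preserving M (S ^^ n)"
proof (induction n)
  case 0
  show ?case by (simp add: measure_preserving_def id_def distr_id)
next
  case (Suc n)
  have S: "S \<in> M \<rightarrow>\<^sub>M M" "distr M M S = M" "S ^^ n \<in> M \<rightarrow>\<^sub>M M" "distr M M (S ^^ n) = M"
    using assms Suc by (auto simp: measure_preserving_def)
  show ?case
    using S distr_distr[OF S(1) S(3)] by (auto simp: measure_preserving_def o_def)
qed

lemma measure_preserving_AE:
  assumes "measure_preserving M S" and "AE x in M. Q x"
  shows "AE x in M. Q (S x)"
  using assms AE_distrD unfolding measure_preserving_def by metis

lemma measure_preserving_integral:
  fixes f :: "'a \<Rightarrow> real"
  assumes "measure_preserving M S" and "f \<in> borel_measurable M"
  shows "(\<integral>x. f (S x) \<partial>M) = (\<integral>x. f x \<partial>M)"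
  using assms integral_distr[of S M M f] by (simp add: measure_preserving_def)

lemma measure_preserving_integrable:
  fixes f :: "'a \<Rightarrow> real"
  assumes "measure_preserving M S" and "integrable M f"
  shows "integrable M (\<lambda>x. f (S x))"
  using assms integrable_distr[of S M M f] by (simp add: measure_preserving_def)

lemma measure_preserving_measure_vimage:
  assumes "measure_preserving M S" and "A \<in> sets M"
  shows "measure M (S -` A \<inter> space M) = measure M A"
  using assms measure_distr[of S M M A] by (simp add: measure_preserving_def)

section \<open>From mixing of sets to correlations of functions\<close>

text \<open>First extension step: the set \<open>B\<close> becomes a function while \<open>A\<close>
  stays a set. As the indicator is at most 1, replacing \<open>f\<close> by an approximant
  \<open>s i\<close> costs at most their L1 distance, uniformly in \<open>n\<close>.\<close>

lemma mixing_integral_indicator: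
  fixes \<psi> :: "'a \<Rightarrow> real"
  assumes "prob_space M" and S: "measure_preserving M S" and mix: "mixing M S"
    and A[measurable]: "A \<in> sets M" and "integrable M \<psi>"
  shows "(\<lambda>n. \<integral>x. indicator A ((S ^^ n) x) * \<psi> x \<partial>M) \<longlonglongrightarrow> measure M A * (\<integral>x. \<psi> x \<partial>M)"
  using \<open>integrable M \<psi>\<close>
proof (induction rule: integrable_induct)
  interpret prob_space M by fact
  have Sn[measurable]: "S ^^ n \<in> M \<rightarrow>\<^sub>M M" for n
    using measure_preserving_funpow[OF S] by (simp add: measure_preserving_def)
  have int: "integrable M (\<lambda>x. indicator A ((S ^^ n) x) * f x)" if "integrable M f"
    for n and f :: "'a \<Rightarrow> real"
  proof -
    have [measurable]: "f \<in> borel_measurable M" using that by simp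
    show ?thesis
      by (rule Bochner_Integration.integrable_bound[OF that]) (auto simp: indicator_def)
  qed
  {
    case (base B c)
    then have [measurable]: "B \<in> sets M" by simp
    have "(\<integral>x. indicator A ((S ^^ n) x) * (indicator B x *\<^sub>R c) \<partial>M) =
        measure M (((S ^^ n) -` A \<inter> space M) \<inter> B) * c" for n
    proof -
      have "(\<integral>x. indicator A ((S ^^ n) x) * (indicator B x *\<^sub>R c) \<partial>M) =
          (\<integral>x. indicator (((S ^^ n) -` A \<inter> space M) \<inter> B) x * c \<partial>M)"
        by (intro Bochner_Integration.integral_cong) (auto simp: indicator_def)
      also have "\<dots> = measure M (((S ^^ n) -` A \<inter> space M) \<inter> B) * c"
        using measurable_sets[OF Sn[of n] A] by simp
      finally show ?thesis .
    qed
    moreover have "(\<lambda>n. measure M (((S ^^ n) -` A \<inter> space M) \<inter> B) * c) \<longlonglongrightarrow>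
        measure M A * measure M B * c"
      using mix base by (intro tendsto_intros) (auto simp: mixing_def)
    ultimately show ?case using base by (simp add: mult.assoc)
  next
    case (add f g)
    then show ?case
      using tendsto_add[OF add.IH] by (simp add: distrib_left int)
  next
    case (lim f s)
    show ?case
    proof (rule tendsto_uniform_approximation[OF lim.IH])
      show "(\<lambda>i. \<integral>x. \<bar>s i x - f x\<bar> \<partial>M) \<longlonglongrightarrow> 0"
        using lim by (intro integral_abs_diff_tendsto_0)
      show "(\<lambda>i. measure M A * (\<integral>x. s i x \<partial>M)) \<longlonglongrightarrow> measure M A * (\<integral>x. f x \<partial>M)"
        using lim by (intro tendsto_intros integral_dominated_convergence[where w="\<lambda>x. 2 * norm (f x)"]) auto
      fix i n
      have "\<bar>(\<integral>x. indicator A ((S ^^ n) x) * s i x \<partial>M) - (\<integral>x. indicator A ((S ^^ n) x) * f x \<partial>M)\<bar>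
          = \<bar>\<integral>x. indicator A ((S ^^ n) x) * (s i x - f x) \<partial>M\<bar>"
        using lim int by (simp add: right_diff_distrib)
      also have "\<dots> \<le> (\<integral>x. \<bar>indicator A ((S ^^ n) x) * (s i x - f x)\<bar> \<partial>M)"
        by (rule integral_abs_bound)
      also have "\<dots> \<le> (\<integral>x. \<bar>s i x - f x\<bar> \<partial>M)"
        using lim by (intro integral_mono integrable_abs int) (auto simp: indicator_def)
      finally show "\<bar>(\<integral>x. indicator A ((S ^^ n) x) * s i x \<partial>M) - (\<integral>x. indicator A ((S ^^ n) x) * f x \<partial>M)\<bar>
          \<le> (\<integral>x. \<bar>s i x - f x\<bar> \<partial>M)" .
    qed
  }
qed

text \<open>Second extension step: induction on the composed factor \<open>\<phi>\<close>, with the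
  indicator case given by the previous lemma. Boundedness of \<open>\<psi>\<close> makes the
  products integrable and the approximation error at most \<open>C\<close> times an L1
  distance.\<close>

lemma mixing_integral:
  fixes \<phi> \<psi> :: "'a \<Rightarrow> real"
  assumes "prob_space M" and S: "measure_preserving M S" and mix: "mixing M S"
    and "integrable M \<phi>" and \<psi>[measurable]: "\<psi> \<in> borel_measurable M"
    and C: "\<And>x. x \<in> space M \<Longrightarrow> \<bar>\<psi> x\<bar> \<le> C"
  shows "(\<lambda>n. \<integral>x. \<phi> ((S ^^ n) x) * \<psi> x \<partial>M) \<longlonglongrightarrow> (\<integral>x. \<phi> x \<partial>M) * (\<integral>x. \<psi> x \<partial>M)"
  using \<open>integrable M \<phi>\<close>
proof (induction rule: integrable_induct)
  interpret prob_space M by fact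
  have Sn: "measure_preserving M (S ^^ n)" for n
    by (rule measure_preserving_funpow[OF S])
  have Sn_meas[measurable]: "S ^^ n \<in> M \<rightarrow>\<^sub>M M" for n
    using Sn by (simp add: measure_preserving_def)
  have \<psi>_int: "integrable M \<psi>"
    by (rule integrable_const_bound[where B=C]) (use C in auto)
  have bd: "\<bar>y * \<psi> x\<bar> \<le> C * \<bar>y\<bar>" if "x \<in> space M" for x y
    using mult_left_mono[OF C[OF that], of "\<bar>y\<bar>"] by (simp add: abs_mult mult.commute)
  have int: "integrable M (\<lambda>x. f ((S ^^ n) x) * \<psi> x)" if f: "integrable M f"
    for n and f :: "'a \<Rightarrow> real"
  proof -
    have [measurable]: "f \<in> borel_measurable M" using f by simp
    have "integrable M (\<lambda>x. C * \<bar>f ((S ^^ n) x)\<bar>)"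
      using measure_preserving_integrable[OF Sn f] by simp
    then show ?thesis
    proof (rule Bochner_Integration.integrable_bound)
      have "norm (f ((S ^^ n) x) * \<psi> x) \<le> norm (C * \<bar>f ((S ^^ n) x)\<bar>)" if "x \<in> space M" for x
        using bd[OF that, of "f ((S ^^ n) x)"] by simp
      then show "AE x in M. norm (f ((S ^^ n) x) * \<psi> x) \<le> norm (C * \<bar>f ((S ^^ n) x)\<bar>)"
        by simp
    qed measurable
  qed
  {
    case (base A c)
    have "(\<lambda>n. c * (\<integral>x. indicator A ((S ^^ n) x) * \<psi> x \<partial>M)) \<longlonglongrightarrow>
        c * (measure M A * (\<integral>x. \<psi> x \<partial>M))"
      using base by (intro tendsto_intros mixing_integral_indicator[OF assms(1-3)] \<psi>_int)
    moreover have "(\<integral>x. (indicator A ((S ^^ n) x) *\<^sub>R c) * \<psi> x \<partial>M) =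
        c * (\<integral>x. indicator A ((S ^^ n) x) * \<psi> x \<partial>M)" for n
    proof -
      have "(\<lambda>x. (indicator A ((S ^^ n) x) *\<^sub>R c) * \<psi> x) =
          (\<lambda>x. c * (indicator A ((S ^^ n) x) * \<psi> x))" by auto
      then show ?thesis by simp
    qed
    ultimately show ?case using base by (simp add: ac_simps)
  next
    case (add f g)
    then show ?case
      using tendsto_add[OF add.IH] by (simp add: distrib_right int)
  next
    case (lim f s)
    have m[measurable]: "f \<in> borel_measurable M" "s i \<in> borel_measurable M" for i
      using lim by auto
    show ?case
    proof (rule tendsto_uniform_approximation[OF lim.IH])
      have "(\<lambda>i. C * (\<integral>x. \<bar>s i x - f x\<bar> \<partial>M)) \<longlonglongrightarrow> C * 0"
        using lim by (intro tendsto_intros integral_abs_diff_tendsto_0)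
      then show "(\<lambda>i. C * (\<integral>x. \<bar>s i x - f x\<bar> \<partial>M)) \<longlonglongrightarrow> 0" by simp
      show "(\<lambda>i. (\<integral>x. s i x \<partial>M) * (\<integral>x. \<psi> x \<partial>M)) \<longlonglongrightarrow> (\<integral>x. f x \<partial>M) * (\<integral>x. \<psi> x \<partial>M)"
        using lim by (intro tendsto_intros integral_dominated_convergence[where w="\<lambda>x. 2 * norm (f x)"]) auto
      fix i n
      have d: "integrable M (\<lambda>x. s i x - f x)" using lim by simp
      have "\<bar>(\<integral>x. s i ((S ^^ n) x) * \<psi> x \<partial>M) - (\<integral>x. f ((S ^^ n) x) * \<psi> x \<partial>M)\<bar>
          = \<bar>\<integral>x. (s i ((S ^^ n) x) - f ((S ^^ n) x)) * \<psi> x \<partial>M\<bar>"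
        using lim int by (simp add: left_diff_distrib)
      also have "\<dots> \<le> (\<integral>x. \<bar>(s i ((S ^^ n) x) - f ((S ^^ n) x)) * \<psi> x\<bar> \<partial>M)"
        by (rule integral_abs_bound)
      also have "\<dots> \<le> (\<integral>x. C * \<bar>s i ((S ^^ n) x) - f ((S ^^ n) x)\<bar> \<partial>M)"
        using bd int[OF d] measure_preserving_integrable[OF Sn d]
        by (intro integral_mono) auto
      \<comment> \<open>Invariance removes the iterate from the integrand, so the error no longer
        depends on \<open>n\<close>.\<close>
      also have "\<dots> = C * (\<integral>x. \<bar>s i x - f x\<bar> \<partial>M)"
        using measure_preserving_integral[OF Sn, of "\<lambda>x. \<bar>s i x - f x\<bar>"] by simp
      finally show "\<bar>(\<integral>x. s i ((S ^^ n) x) * \<psi> x \<partial>M) - (\<integral>x. f ((S ^^ n) x) * \<psi> x \<partial>M)\<bar>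
          \<le> C * (\<integral>x. \<bar>s i x - f x\<bar> \<partial>M)" .
    qed
  }
qed

section \<open>Reduction of mixing to an intersection-stable generator\<close>

text \<open>For fixed \<open>B\<close>, the good sets \<open>A\<close> form a Dynkin system.
  Complements are handled by subtraction; disjoint unions require exchanging the limit in
  \<open>n\<close> with an infinite sum.\<close>

lemma mixing_if_generator:
  assumes "prob_space M" and S: "measure_preserving M S"
    and G: "Int_stable G" "G \<subseteq> Pow (space M)" "sets M = sigma_sets (space M) G"
    and conv: "\<And>A B. A \<in> G \<Longrightarrow> B \<in> sets M \<Longrightarrow>
      (\<lambda>n. measure M (((S ^^ n) -` A \<inter> space M) \<inter> B)) \<longlonglongrightarrow> measure M A * measure M B"
  shows "mixing M S"
  unfolding mixing_def
proof (intro ballI)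
  interpret prob_space M by fact
  fix A B assume A: "A \<in> sets M" and B: "B \<in> sets M"
  have Sn: "measure_preserving M (S ^^ n)" for n
    by (rule measure_preserving_funpow[OF S])
  then have meas: "S ^^ n \<in> M \<rightarrow>\<^sub>M M" for n
    by (simp add: measure_preserving_def)
  have [simp]: "(S ^^ n) -` A \<inter> space M \<in> sets M" if "A \<in> sets M" for A n
    using measurable_sets[OF meas that] .
  have "A \<in> sigma_sets (space M) G" using A G(3) by simp
  with G(1,2) show "(\<lambda>n. measure M (((S ^^ n) -` A \<inter> space M) \<inter> B)) \<longlonglongrightarrow> measure M A * measure M B"
  proof (induction rule: sigma_sets_induct_disjoint)
    case (basic A)
    then show ?case using conv B by simp
  next
    case empty
    show ?case by simp
  next
    case (compl A)
    then have A: "A \<in> sets M" using G(3) by simp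
    have "measure M (((S ^^ n) -` (space M - A) \<inter> space M) \<inter> B) =
        measure M B - measure M (((S ^^ n) -` A \<inter> space M) \<inter> B)" for n
    proof -
      have "((S ^^ n) -` (space M - A) \<inter> space M) \<inter> B = B - ((S ^^ n) -` A \<inter> space M) \<inter> B"
        using measurable_space[OF meas] sets.sets_into_space[OF B] by auto
      moreover have "measure M (B - ((S ^^ n) -` A \<inter> space M) \<inter> B) =
          measure M B - measure M (((S ^^ n) -` A \<inter> space M) \<inter> B)"
        using A B by (intro finite_measure_Diff) auto
      ultimately show ?thesis by simp
    qed
    moreover have "(\<lambda>n. measure M B - measure M (((S ^^ n) -` A \<inter> space M) \<inter> B)) \<longlonglongrightarrow>
        measure M B - measure M A * measure M B"
      by (intro tendsto_intros compl.IH)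
    ultimately show ?case using A by (simp add: prob_compl left_diff_distrib)
  next
    case (union F)
    have F: "F i \<in> sets M" for i using union(2) G(3) by auto
    let ?a = "\<lambda>i n. measure M (((S ^^ n) -` F i \<inter> space M) \<inter> B)"
    have sums: "(\<lambda>i. ?a i n) sums measure M (((S ^^ n) -` (\<Union>i. F i) \<inter> space M) \<inter> B)" for n
    proof -
      have eq: "((S ^^ n) -` (\<Union>i. F i) \<inter> space M) \<inter> B = (\<Union>i. ((S ^^ n) -` F i \<inter> space M) \<inter> B)"
        by auto
      have "((S ^^ n) -` F i \<inter> space M) \<inter> B \<in> sets M" for i
        using F B by auto
      moreover have "disjoint_family (\<lambda>i. ((S ^^ n) -` F i \<inter> space M) \<inter> B)"
        using union(1) unfolding disjoint_family_on_def by blast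
      ultimately show ?thesis
        unfolding eq by (intro finite_measure_UNION image_subsetI)
    qed
    have sumF: "(\<lambda>i. measure M (F i)) sums measure M (\<Union>i. F i)"
      using F union(1) by (intro finite_measure_UNION) auto
    \<comment> \<open>Dropping \<open>B\<close> and using invariance gives a bound that is
      independent of \<open>n\<close> and summable in \<open>i\<close>, which is the domination that
      Tannery's theorem asks for.\<close>
    have "norm (?a i n) \<le> measure M (F i)" for i n
    proof -
      have "?a i n \<le> measure M ((S ^^ n) -` F i \<inter> space M)"
        using F by (intro finite_measure_mono) auto
      then show ?thesis using measure_preserving_measure_vimage[OF Sn F] by simp
    qed
    then have "(\<lambda>n. \<Sum>i. ?a i n) \<longlonglongrightarrow> (\<Sum>i. measure M (F i) * measure M B)"
      using tannerys_theorem[where a = ?a and M = "\<lambda>i. measure M (F i)", OF union.IH] sumF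
      by (auto simp: sums_iff intro: always_eventually)
    moreover have "(\<Sum>i. measure M (F i) * measure M B) = measure M (\<Union>i. F i) * measure M B"
      by (rule sums_unique[OF sums_mult2[OF sumF], symmetric])
    moreover have "(\<lambda>n. \<Sum>i. ?a i n) = (\<lambda>n. measure M (((S ^^ n) -` (\<Union>i. F i) \<inter> space M) \<inter> B))"
      using sums_unique[OF sums, symmetric] by (rule ext)
    ultimately show ?case by (simp only:)
  qed
qed

section \<open>Skew products of Perron--Frobenius cocycles\<close>

lemma indicator_in_Linf:
  assumes [measurable]: "E \<in> sets m"
  shows "(indicator E :: 'x \<Rightarrow> real) \<in> Linf m"
proof -
  have "esssup m (\<lambda>x. ereal \<bar>indicator E x\<bar>) \<le> 1"
    by (rule esssup_I) (auto simp: indicator_def)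
  then show ?thesis by (auto simp: Linf_def)
qed

text \<open>A constant map is measurable for every sigma-algebra on its target, so the Borel
  structure of the essentially bounded functions need not be examined further.\<close>

lemma constant_in_bounded_Linf_maps:
  assumes "g \<in> Linf m"
  shows "(\<lambda>_. g) \<in> bounded_Linf_maps \<P> m"
proof -
  have "space (Linf_borel m) = Linf m"
    unfolding Linf_borel_def seminorm_borel_def by (rule space_measure_of) auto
  then show ?thesis
    using assms by (auto simp: bounded_Linf_maps_def)
qed

text \<open>Duality tested on \<open>indicator E\<close>. Writing the pulled-back indicator as that
  of a preimage inside \<open>space m\<close> allows the identity to be iterated, since the preimage
  can again play the role of \<open>E\<close>.\<close>

lemma perron_frobenius_operator_indicator:
  assumes L: "perron_frobenius_operator m S L" and f: "f \<in> L1 m" and E: "E \<in> sets m"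
  shows "(\<integral>x. L f x * indicator E x \<partial>m) = (\<integral>x. f x * indicator (S -` E \<inter> space m) x \<partial>m)"
proof -
  have "(\<integral>x. L f x * indicator E x \<partial>m) = (\<integral>x. f x * indicator E (S x) \<partial>m)"
    using L f indicator_in_Linf[OF E] by (auto simp: perron_frobenius_operator_def)
  also have "\<dots> = (\<integral>x. f x * indicator (S -` E \<inter> space m) x \<partial>m)"
    by (intro Bochner_Integration.integral_cong) (auto simp: indicator_def)
  finally show ?thesis .
qed

lemma fibre_measure_alt: "fibre_measure m h \<omega> E = (\<integral>x. h \<omega> x * indicator E x \<partial>m)"
  by (simp add: fibre_measure_def set_lebesgue_integral_def mult.commute)

section \<open>Fibre measures and the measure on the total space\<close>

locale perron_frobenius_cocycle =
  fixes \<P> :: "'w measure" and m :: "'x measure"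
    and \<sigma> :: "'w \<Rightarrow> 'w" and T :: "'w \<Rightarrow> 'x \<Rightarrow> 'x"
    and P :: "'w \<Rightarrow> ('x \<Rightarrow> real) \<Rightarrow> 'x \<Rightarrow> real" and h :: "'w \<Rightarrow> 'x \<Rightarrow> real"
  assumes prob_base: "prob_space \<P>" and prob_fibre: "prob_space m"
    and base_preserving: "measure_preserving \<P> \<sigma>"
    and T_measurable: "(\<lambda>(\<omega>, x). T \<omega> x) \<in> \<P> \<Otimes>\<^sub>M m \<rightarrow>\<^sub>M m"
    and perron_frobenius: "AE \<omega> in \<P>. perron_frobenius_operator m (T \<omega>) (P \<omega>)"
    and invariant_density: "invariant_density_map \<P> m P \<sigma> h"
begin

abbreviation \<Theta> :: "'w \<times> 'x \<Rightarrow> 'w \<times> 'x" where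
  "\<Theta> \<equiv> skew_product \<sigma> T"

abbreviation \<nu> :: "('w \<times> 'x) measure" where
  "\<nu> \<equiv> skew_measure \<P> m h"

abbreviation \<mu> :: "'w \<Rightarrow> 'x set \<Rightarrow> real" where
  "\<mu> \<equiv> fibre_measure m h"

definition fibre :: "('w \<times> 'x) set \<Rightarrow> 'w \<Rightarrow> 'x set" where
  "fibre A \<omega> = {x\<in>space m. (\<omega>, x) \<in> A}"

text \<open>This is the fibre cocycle, the composition of the maps
  \<open>T ((\<sigma> ^^ k) \<omega>)\<close> for \<open>k < n\<close>. Reading it off the iterate
  of \<open>\<Theta>\<close> lets its measurability be inherited from that of
  \<open>\<Theta>\<close>.\<close>

definition orbit :: "nat \<Rightarrow> 'w \<Rightarrow> 'x \<Rightarrow> 'x" where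
  "orbit n \<omega> x = snd ((\<Theta> ^^ n) (\<omega>, x))"

text \<open>Bundles the two almost sure properties of a base point, so that one exceptional null set
  can be removed along whole orbits.\<close>

definition regular :: "'w \<Rightarrow> bool" where
  "regular \<omega> \<longleftrightarrow> perron_frobenius_operator m (T \<omega>) (P \<omega>) \<and> (AE x in m. P \<omega> (h \<omega>) x = h (\<sigma> \<omega>) x)"

sublocale base: prob_space \<P> by (rule prob_base)

sublocale fibre: prob_space m by (rule prob_fibre)

lemma density_measurable: "h \<in> \<P> \<rightarrow>\<^sub>M restrict_space (L1_borel m) (densities m)"
  using invariant_density by (simp add: invariant_density_map_def)

sublocale total: prob_space \<nu>
  by (rule prob_space_skew_measure[OF prob_base prob_fibre density_measurable])

lemmas sets_\<nu> = sets_skew_measure[OF prob_base prob_fibre density_measurable]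

lemmas space_\<nu> = space_skew_measure[OF prob_base prob_fibre density_measurable]

lemma base_funpow_measurable: "\<sigma> ^^ n \<in> \<P> \<rightarrow>\<^sub>M \<P>"
  using measure_preserving_funpow[OF base_preserving] by (simp add: measure_preserving_def)

lemma base_funpow_space: "\<omega> \<in> space \<P> \<Longrightarrow> (\<sigma> ^^ n) \<omega> \<in> space \<P>"
  by (rule measurable_space[OF base_funpow_measurable])

lemma fibre_sets: "A \<in> sets (\<P> \<Otimes>\<^sub>M m) \<Longrightarrow> \<omega> \<in> space \<P> \<Longrightarrow> fibre A \<omega> \<in> sets m"
  unfolding fibre_def by (rule section_sets[OF prob_base prob_fibre density_measurable])

lemma density_L1: "\<omega> \<in> space \<P> \<Longrightarrow> h \<omega> \<in> L1 m"
  and density_nonneg: "\<omega> \<in> space \<P> \<Longrightarrow> AE x in m. 0 \<le> h \<omega> x"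
  using density_map_in_densities[OF prob_base prob_fibre density_measurable]
  by (auto simp: densities_def)

lemma L1_mult_indicator:
  assumes "f \<in> L1 m" and E: "E \<in> sets m"
  shows "integrable m (\<lambda>x. f x * indicator E x)"
  using assms integrable_real_mult_indicator[of E m f] by (simp add: L1_def mult.commute)

text \<open>\<open>E\<close> may be arbitrary: if the integrand is not integrable, its Bochner
  integral is 0 by convention.\<close>

lemma \<mu>_nonneg: "\<omega> \<in> space \<P> \<Longrightarrow> 0 \<le> \<mu> \<omega> E"
  unfolding fibre_measure_alt
  using density_nonneg[of \<omega>] by (intro integral_nonneg_AE) (auto elim!: eventually_mono)

lemma \<mu>_mono:
  assumes "\<omega> \<in> space \<P>" "E \<in> sets m" "F \<in> sets m" "E \<subseteq> F"
  shows "\<mu> \<omega> E \<le> \<mu> \<omega> F"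
  unfolding fibre_measure_alt
proof (rule integral_mono_AE)
  show "AE x in m. h \<omega> x * indicator E x \<le> h \<omega> x * indicator F x"
    using density_nonneg[OF assms(1)] assms(4)
    by (auto elim!: eventually_mono simp: indicator_def)
qed (use assms in \<open>auto intro!: L1_mult_indicator density_L1\<close>)

lemma \<mu>_space: "\<omega> \<in> space \<P> \<Longrightarrow> \<mu> \<omega> (space m) = 1"
  by (rule fibre_measure_space[OF prob_base prob_fibre density_measurable])

lemma \<mu>_le_1: "\<omega> \<in> space \<P> \<Longrightarrow> E \<in> sets m \<Longrightarrow> \<mu> \<omega> E \<le> 1"
  using \<mu>_mono[of \<omega> E "space m"] sets.sets_into_space[of E m] by (simp add: \<mu>_space)

lemma \<mu>_fibre_measurable:
  assumes A: "A \<in> sets (\<P> \<Otimes>\<^sub>M m)"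
  shows "(\<lambda>\<omega>. \<mu> \<omega> (fibre A \<omega>)) \<in> borel_measurable \<P>"
proof -
  \<comment> \<open>Measurability is available for the \<open>ennreal\<close>-valued version;
    nonnegativity makes the round trip through \<open>ennreal\<close> the identity.\<close>
  have "(\<lambda>\<omega>. enn2real (ennreal (\<mu> \<omega> (fibre A \<omega>)))) \<in> borel_measurable \<P>"
    unfolding fibre_def
    using fibre_measure_measurable[OF prob_base prob_fibre density_measurable A] by measurable
  then show ?thesis
    using \<mu>_nonneg by (simp cong: measurable_cong)
qed

lemma \<mu>_fibre_integrable:
  assumes A: "A \<in> sets (\<P> \<Otimes>\<^sub>M m)"
  shows "integrable \<P> (\<lambda>\<omega>. \<mu> \<omega> (fibre A \<omega>))"
  using \<mu>_fibre_measurable[OF A] \<mu>_nonneg \<mu>_le_1 fibre_sets[OF A]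
  by (intro base.integrable_const_bound[where B=1]) auto

lemma emeasure_\<nu>:
  "A \<in> sets (\<P> \<Otimes>\<^sub>M m) \<Longrightarrow> emeasure \<nu> A = (\<integral>\<^sup>+\<omega>. ennreal (\<mu> \<omega> (fibre A \<omega>)) \<partial>\<P>)"
  unfolding fibre_def by (rule emeasure_skew_measure[OF prob_base prob_fibre density_measurable])

lemma measure_\<nu>:
  assumes A: "A \<in> sets (\<P> \<Otimes>\<^sub>M m)"
  shows "measure \<nu> A = (\<integral>\<omega>. \<mu> \<omega> (fibre A \<omega>) \<partial>\<P>)"
  unfolding measure_def emeasure_\<nu>[OF A]
  using \<mu>_fibre_measurable[OF A] \<mu>_nonneg by (intro integral_eq_nn_integral[symmetric]) auto

section \<open>The skew product and its fibre orbits\<close>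

lemma skew_product_measurable: "\<Theta> \<in> \<P> \<Otimes>\<^sub>M m \<rightarrow>\<^sub>M \<P> \<Otimes>\<^sub>M m"
proof -
  have [measurable]: "\<sigma> \<in> \<P> \<rightarrow>\<^sub>M \<P>" "(\<lambda>(\<omega>, x). T \<omega> x) \<in> \<P> \<Otimes>\<^sub>M m \<rightarrow>\<^sub>M m"
    using base_funpow_measurable[of 1] T_measurable by simp_all
  have "\<Theta> = (\<lambda>p. (\<sigma> (fst p), (\<lambda>(\<omega>, x). T \<omega> x) p))"
    by (auto simp: skew_product_def)
  then show ?thesis by simp
qed

lemma skew_product_funpow_measurable: "\<Theta> ^^ n \<in> \<P> \<Otimes>\<^sub>M m \<rightarrow>\<^sub>M \<P> \<Otimes>\<^sub>M m"
proof (induction n)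
  case (Suc n)
  show ?case using measurable_comp[OF Suc skew_product_measurable] by (simp add: o_def)
qed (simp add: id_def)

lemma skew_product_funpow: "(\<Theta> ^^ n) (\<omega>, x) = ((\<sigma> ^^ n) \<omega>, orbit n \<omega> x)"
proof -
  have "fst ((\<Theta> ^^ n) (\<omega>, x)) = (\<sigma> ^^ n) \<omega>"
    by (induction n) (auto simp: skew_product_def split_beta)
  then show ?thesis by (simp add: orbit_def prod_eq_iff)
qed

lemma orbit_0: "orbit 0 \<omega> x = x"
  by (simp add: orbit_def)

lemma orbit_Suc: "orbit (Suc n) \<omega> x = T ((\<sigma> ^^ n) \<omega>) (orbit n \<omega> x)"
  by (simp add: orbit_def[of "Suc n"] skew_product_funpow) (simp add: skew_product_def)

lemma T_fibre_measurable: "\<omega> \<in> space \<P> \<Longrightarrow> T \<omega> \<in> m \<rightarrow>\<^sub>M m"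
  using measurable_Pair2[OF T_measurable] by simp

lemma orbit_measurable: "\<omega> \<in> space \<P> \<Longrightarrow> orbit n \<omega> \<in> m \<rightarrow>\<^sub>M m"
  unfolding orbit_def
  by (rule measurable_compose[OF measurable_Pair2[OF skew_product_funpow_measurable] measurable_snd])

text \<open>The outermost map is peeled off, in step with \<open>cocycle_iterate\<close>, whose last
  operator sits over the same base point. In the inductions below \<open>E\<close> is therefore
  replaced by a preimage, so they are stated for arbitrary \<open>E\<close>.\<close>

lemma vimage_orbit_Suc:
  "\<omega> \<in> space \<P> \<Longrightarrow> orbit (Suc n) \<omega> -` E \<inter> space m =
    orbit n \<omega> -` (T ((\<sigma> ^^ n) \<omega>) -` E \<inter> space m) \<inter> space m"
  using measurable_space[OF orbit_measurable] by (auto simp: orbit_Suc)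

section \<open>Transport of fibre measures and densities along orbits\<close>

text \<open>Invariance of the base measure makes the exceptional set null for each iterate, and
  there are only countably many iterates.\<close>

lemma AE_regular: "AE \<omega> in \<P>. \<forall>n. regular ((\<sigma> ^^ n) \<omega>)"
proof -
  have "AE \<omega> in \<P>. regular \<omega>"
    using perron_frobenius invariant_density
    by (auto simp: regular_def invariant_density_map_def)
  then show ?thesis
    using measure_preserving_AE[OF measure_preserving_funpow[OF base_preserving]]
    by (simp add: AE_all_countable)
qed

text \<open>Duality applied to the density \<open>h \<omega>\<close> produces
  \<open>P \<omega> (h \<omega>)\<close>, which agrees almost everywhere with
  \<open>h (\<sigma> \<omega>)\<close> and may be replaced by it under the integral.\<close>

lemma \<mu>_vimage:
  assumes \<omega>: "\<omega> \<in> space \<P>" and reg: "regular \<omega>" and E: "E \<in> sets m"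
  shows "\<mu> \<omega> (T \<omega> -` E \<inter> space m) = \<mu> (\<sigma> \<omega>) E"
proof -
  have L: "perron_frobenius_operator m (T \<omega>) (P \<omega>)" and inv: "AE x in m. P \<omega> (h \<omega>) x = h (\<sigma> \<omega>) x"
    using reg by (auto simp: regular_def)
  have PL: "P \<omega> (h \<omega>) \<in> L1 m" and hL: "h (\<sigma> \<omega>) \<in> L1 m"
    using L density_L1[OF \<omega>] density_L1[OF base_funpow_space[OF \<omega>, of 1]]
    by (auto simp: perron_frobenius_operator_def)
  have "\<mu> \<omega> (T \<omega> -` E \<inter> space m) = (\<integral>x. P \<omega> (h \<omega>) x * indicator E x \<partial>m)"
    unfolding fibre_measure_alt
    by (rule perron_frobenius_operator_indicator[symmetric, OF L density_L1[OF \<omega>] E])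
  also have "\<dots> = \<mu> (\<sigma> \<omega>) E"
    unfolding fibre_measure_alt
    using inv borel_measurable_integrable[OF L1_mult_indicator[OF PL E]]
      borel_measurable_integrable[OF L1_mult_indicator[OF hL E]]
    by (intro integral_cong_AE) (auto elim!: eventually_mono)
  finally show ?thesis .
qed

lemma \<mu>_vimage_orbit:
  assumes \<omega>: "\<omega> \<in> space \<P>" and reg: "\<forall>n. regular ((\<sigma> ^^ n) \<omega>)" and E: "E \<in> sets m"
  shows "\<mu> \<omega> (orbit n \<omega> -` E \<inter> space m) = \<mu> ((\<sigma> ^^ n) \<omega>) E"
  using E
proof (induction n arbitrary: E)
  case 0
  then show ?case
    using sets.sets_into_space[of E m] by (auto simp: orbit_0 intro!: arg_cong[where f="\<mu> \<omega>"])
next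
  case (Suc n)
  have "T ((\<sigma> ^^ n) \<omega>) -` E \<inter> space m \<in> sets m"
    using measurable_sets[OF T_fibre_measurable Suc.prems] base_funpow_space[OF \<omega>] by simp
  then show ?case
    unfolding vimage_orbit_Suc[OF \<omega>]
    using \<mu>_vimage[OF base_funpow_space[OF \<omega>] _ Suc.prems] reg by (subst Suc.IH) simp_all
qed

text \<open>Iterated duality: it converts the integrals in the prior mixing condition into integrals
  over preimages under the fibre orbit.\<close>

lemma integral_cocycle_iterate_indicator:
  assumes \<omega>: "\<omega> \<in> space \<P>" and reg: "\<forall>n. regular ((\<sigma> ^^ n) \<omega>)"
    and f: "f \<in> L1 m" and E: "E \<in> sets m"
  shows "(\<integral>x. cocycle_iterate P \<sigma> n \<omega> f x * indicator E x \<partial>m) =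
    (\<integral>x. f x * indicator (orbit n \<omega> -` E \<inter> space m) x \<partial>m)"
  using E
proof (induction n arbitrary: E)
  case 0
  show ?case
    by (intro Bochner_Integration.integral_cong) (auto simp: orbit_0 indicator_def)
next
  case (Suc n)
  \<comment> \<open>Stated for every index, because the inner induction showing that the iterate of
    \<open>f\<close> stays in \<open>L1 m\<close> uses all earlier base points.\<close>
  have L: "perron_frobenius_operator m (T ((\<sigma> ^^ n) \<omega>)) (P ((\<sigma> ^^ n) \<omega>))" for n
    using reg by (simp add: regular_def)
  have "cocycle_iterate P \<sigma> n \<omega> f \<in> L1 m"
    using f L by (induction n) (auto simp: perron_frobenius_operator_def)
  moreover have "T ((\<sigma> ^^ n) \<omega>) -` E \<inter> space m \<in> sets m"
    using measurable_sets[OF T_fibre_measurable Suc.prems] base_funpow_space[OF \<omega>] by simp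
  ultimately show ?case
    unfolding vimage_orbit_Suc[OF \<omega>]
    using perron_frobenius_operator_indicator[OF L _ Suc.prems] by (subst Suc.IH[symmetric]) simp_all
qed

text \<open>Over a regular point the fibre of the preimage of \<open>A\<close> is the
  \<open>T \<omega>\<close>-preimage of the fibre of \<open>A\<close> over
  \<open>\<sigma> \<omega>\<close>. By \<open>\<mu>_vimage\<close> the integrand becomes a function
  of \<open>\<sigma> \<omega>\<close>, and invariance of the base measure finishes.\<close>

lemma skew_product_measure_preserving: "measure_preserving \<nu> \<Theta>"
proof -
  have meas: "\<Theta> \<in> \<nu> \<rightarrow>\<^sub>M \<nu>"
    using skew_product_measurable by (simp add: measurable_cong_sets[OF sets_\<nu> sets_\<nu>])
  moreover have "distr \<nu> \<nu> \<Theta> = \<nu>"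
  proof (rule measure_eqI)
    fix A assume "A \<in> sets (distr \<nu> \<nu> \<Theta>)"
    then have A: "A \<in> sets (\<P> \<Otimes>\<^sub>M m)" by (simp add: sets_\<nu>)
    let ?A = "\<Theta> -` A \<inter> space \<nu>"
    have A': "?A \<in> sets (\<P> \<Otimes>\<^sub>M m)"
      using measurable_sets[OF skew_product_measurable A] by (simp add: space_\<nu>)
    have "emeasure (distr \<nu> \<nu> \<Theta>) A = emeasure \<nu> ?A"
      using A meas by (simp add: emeasure_distr sets_\<nu>)
    also have "\<dots> = (\<integral>\<^sup>+\<omega>. ennreal (\<mu> \<omega> (fibre ?A \<omega>)) \<partial>\<P>)"
      by (rule emeasure_\<nu>[OF A'])
    also have "\<dots> = (\<integral>\<^sup>+\<omega>. ennreal (\<mu> (\<sigma> \<omega>) (fibre A (\<sigma> \<omega>))) \<partial>\<P>)"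
    proof (rule nn_integral_cong_AE)
      show "AE \<omega> in \<P>. ennreal (\<mu> \<omega> (fibre ?A \<omega>)) = ennreal (\<mu> (\<sigma> \<omega>) (fibre A (\<sigma> \<omega>)))"
        using AE_regular AE_space
      proof eventually_elim
        case (elim \<omega>)
        have \<sigma>\<omega>: "\<sigma> \<omega> \<in> space \<P>" using base_funpow_space[OF elim(2), of 1] by simp
        have "fibre ?A \<omega> = T \<omega> -` fibre A (\<sigma> \<omega>) \<inter> space m"
          using elim(2) measurable_space[OF T_fibre_measurable[OF elim(2)]]
          by (auto simp: fibre_def skew_product_def space_\<nu> space_pair_measure)
        moreover have "regular \<omega>" using elim(1) by (metis funpow_0)
        ultimately show ?case
          using \<mu>_vimage[OF elim(2) _ fibre_sets[OF A \<sigma>\<omega>]] by simp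
      qed
    qed
    also have "\<dots> = (\<integral>\<^sup>+\<omega>. ennreal (\<mu> \<omega> (fibre A \<omega>)) \<partial>distr \<P> \<P> \<sigma>)"
      using base_preserving \<mu>_fibre_measurable[OF A]
      by (intro nn_integral_distr[symmetric]) (auto simp: measure_preserving_def)
    also have "\<dots> = emeasure \<nu> A"
      using base_preserving emeasure_\<nu>[OF A] by (simp add: measure_preserving_def)
    finally show "emeasure (distr \<nu> \<nu> \<Theta>) A = emeasure \<nu> A" .
  qed simp
  ultimately show ?thesis by (simp add: measure_preserving_def)
qed

text \<open>
  Prior mixing is applied to the zero-mean function \<open>(1\<^sub>B - \<mu>\<^sub>\<omega>(B)) h\<^sub>\<omega>\<close> and to the constant
  observable \<open>1\<^sub>E\<close>.
\<close>

lemma fibrewise_decorrelation: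
  assumes \<omega>: "\<omega> \<in> space \<P>" and reg: "\<forall>n. regular ((\<sigma> ^^ n) \<omega>)"
    and prior: "\<forall>f\<in>L1_zero m. \<forall>g\<in>bounded_Linf_maps \<P> m.
      (\<lambda>n. \<integral>x. cocycle_iterate P \<sigma> n \<omega> f x * g ((\<sigma> ^^ n) \<omega>) x \<partial>m) \<longlonglongrightarrow> 0"
    and B: "B \<in> sets m" and E: "E \<in> sets m"
  shows "(\<lambda>n. \<mu> \<omega> ((orbit n \<omega> -` E \<inter> space m) \<inter> B) - \<mu> ((\<sigma> ^^ n) \<omega>) E * \<mu> \<omega> B) \<longlonglongrightarrow> 0"
proof -
  define f where "f x = h \<omega> x * indicator B x - \<mu> \<omega> B * h \<omega> x" for x
  have hi: "integrable m (h \<omega>)"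
    using density_L1[OF \<omega>] by (simp add: L1_def)
  have hBi: "integrable m (\<lambda>x. h \<omega> x * indicator B x)"
    by (rule L1_mult_indicator[OF density_L1[OF \<omega>] B])
  have "(\<integral>x. h \<omega> x \<partial>m) = 1"
    using \<mu>_space[OF \<omega>] hi by (simp add: fibre_measure_def set_integral_space)
  then have "(\<integral>x. f x \<partial>m) = 0"
    unfolding f_def using hi hBi by (simp add: fibre_measure_alt)
  moreover have f: "f \<in> L1 m"
    unfolding L1_def f_def using hi hBi by simp
  ultimately have "f \<in> L1_zero m"
    by (simp add: L1_zero_def)
  then have "(\<lambda>n. \<integral>x. cocycle_iterate P \<sigma> n \<omega> f x * indicator E x \<partial>m) \<longlonglongrightarrow> 0"
    using prior constant_in_bounded_Linf_maps[OF indicator_in_Linf[OF E], of \<P>] by fast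
  \<comment> \<open>For each \<open>n\<close> the integral equals the fibrewise correlation exactly:
    iterated duality pulls \<open>E\<close> back, and \<open>\<mu>_vimage_orbit\<close> evaluates
    the term carrying the mean of \<open>B\<close>.\<close>
  moreover have "(\<integral>x. cocycle_iterate P \<sigma> n \<omega> f x * indicator E x \<partial>m) =
      \<mu> \<omega> ((orbit n \<omega> -` E \<inter> space m) \<inter> B) - \<mu> ((\<sigma> ^^ n) \<omega>) E * \<mu> \<omega> B" for n
  proof -
    let ?E = "orbit n \<omega> -` E \<inter> space m"
    have E': "?E \<in> sets m"
      by (rule measurable_sets[OF orbit_measurable[OF \<omega>] E])
    have "(\<integral>x. cocycle_iterate P \<sigma> n \<omega> f x * indicator E x \<partial>m) = (\<integral>x. f x * indicator ?E x \<partial>m)"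
      by (rule integral_cocycle_iterate_indicator[OF \<omega> reg f E])
    also have "\<dots> = (\<integral>x. h \<omega> x * indicator (?E \<inter> B) x - \<mu> \<omega> B * (h \<omega> x * indicator ?E x) \<partial>m)"
      by (intro Bochner_Integration.integral_cong) (auto simp: f_def indicator_def)
    also have "\<dots> = \<mu> \<omega> (?E \<inter> B) - \<mu> \<omega> B * \<mu> \<omega> ?E"
      using B E' density_L1[OF \<omega>] L1_mult_indicator
      unfolding fibre_measure_alt by (subst Bochner_Integration.integral_diff) auto
    finally show ?thesis
      using \<mu>_vimage_orbit[OF \<omega> reg E] by (simp add: mult.commute)
  qed
  ultimately show ?thesis by simp
qed

section \<open>Decorrelation on rectangles and mixing of the skew product\<close>

text \<open>The fibre of a rectangle over any base point is \<open>E\<close> or empty, so the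
  constant observable \<open>indicator E\<close> serves all \<open>n\<close>. The side
  \<open>F\<close> enters only as a scalar factor evaluated at
  \<open>(\<sigma> ^^ n) \<omega>\<close>.\<close>

lemma rectangle_decorrelation:
  assumes mix: "mixing \<P> \<sigma>" and prior: "prior_mixing_inhomogeneous \<P> m P \<sigma>"
    and F: "F \<in> sets \<P>" and E: "E \<in> sets m" and B: "B \<in> sets (\<P> \<Otimes>\<^sub>M m)"
  shows "(\<lambda>n. measure \<nu> (((\<Theta> ^^ n) -` (F \<times> E) \<inter> space \<nu>) \<inter> B)) \<longlonglongrightarrow>
    measure \<nu> (F \<times> E) * measure \<nu> B"
proof -
  let ?A = "F \<times> E"
  let ?An = "\<lambda>n. ((\<Theta> ^^ n) -` ?A \<inter> space \<nu>) \<inter> B"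
  have A: "?A \<in> sets (\<P> \<Otimes>\<^sub>M m)" using F E by simp
  have An: "?An n \<in> sets (\<P> \<Otimes>\<^sub>M m)" for n
    using measurable_sets[OF skew_product_funpow_measurable A] B by (auto simp: space_\<nu>)
  let ?\<phi> = "\<lambda>\<omega>. \<mu> \<omega> (fibre ?A \<omega>)" and ?\<psi> = "\<lambda>\<omega>. \<mu> \<omega> (fibre B \<omega>)"
  let ?d = "\<lambda>n \<omega>. \<mu> \<omega> (fibre (?An n) \<omega>) - ?\<phi> ((\<sigma> ^^ n) \<omega>) * ?\<psi> \<omega>"
  note bounds = \<mu>_nonneg \<mu>_le_1 fibre_sets base_funpow_space
  note [measurable] = \<mu>_fibre_measurable[OF A] \<mu>_fibre_measurable[OF B] \<mu>_fibre_measurable[OF An]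
    base_funpow_measurable
  have prod: "0 \<le> ?\<phi> ((\<sigma> ^^ n) \<omega>) * ?\<psi> \<omega>" "?\<phi> ((\<sigma> ^^ n) \<omega>) * ?\<psi> \<omega> \<le> 1"
    if "\<omega> \<in> space \<P>" for n \<omega>
    using that A B by (auto intro!: mult_nonneg_nonneg mult_le_one bounds)
  have prod_int: "integrable \<P> (\<lambda>\<omega>. ?\<phi> ((\<sigma> ^^ n) \<omega>) * ?\<psi> \<omega>)" for n
    using prod by (intro base.integrable_const_bound[where B=1]) auto
  \<comment> \<open>Both terms of \<open>?d\<close> lie between 0 and 1, so on a probability space
    the constant 1 dominates and fibrewise convergence suffices.\<close>
  have "(\<lambda>n. \<integral>\<omega>. ?d n \<omega> \<partial>\<P>) \<longlonglongrightarrow> (\<integral>\<omega>. 0 \<partial>\<P>)"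
  proof (rule integral_dominated_convergence[where w="\<lambda>_. 1"])
    show "AE \<omega> in \<P>. (\<lambda>n. ?d n \<omega>) \<longlonglongrightarrow> 0"
      using AE_regular prior[unfolded prior_mixing_inhomogeneous_def] AE_space
    proof eventually_elim
      case (elim \<omega>)
      let ?c = "\<lambda>n. \<mu> \<omega> ((orbit n \<omega> -` E \<inter> space m) \<inter> fibre B \<omega>) -
          \<mu> ((\<sigma> ^^ n) \<omega>) E * \<mu> \<omega> (fibre B \<omega>)"
      have "?c \<longlonglongrightarrow> 0"
        using elim by (intro fibrewise_decorrelation E fibre_sets[OF B])
      moreover have "?d n \<omega> = indicator F ((\<sigma> ^^ n) \<omega>) * ?c n" for n
      proof (cases "(\<sigma> ^^ n) \<omega> \<in> F")
        case True
        then have "fibre (?An n) \<omega> = (orbit n \<omega> -` E \<inter> space m) \<inter> fibre B \<omega>"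
          using elim(3) by (auto simp: fibre_def skew_product_funpow space_\<nu> space_pair_measure)
        moreover have "fibre ?A ((\<sigma> ^^ n) \<omega>) = E"
          using True sets.sets_into_space[OF E] by (auto simp: fibre_def)
        ultimately show ?thesis using True by simp
      next
        case False
        then have "fibre (?An n) \<omega> = {}" "fibre ?A ((\<sigma> ^^ n) \<omega>) = {}"
          by (auto simp: fibre_def skew_product_funpow)
        then show ?thesis using False by (simp add: fibre_measure_alt)
      qed
      \<comment> \<open>The indicator factor need not converge along the orbit; it suffices that it
        is bounded by 1 and multiplies a null sequence.\<close>
      moreover have "(\<lambda>n. indicator F ((\<sigma> ^^ n) \<omega>) * ?c n) \<longlonglongrightarrow> 0" if "?c \<longlonglongrightarrow> 0"
        by (rule tendsto_rabs_zero_cancel, rule tendsto_sandwich[OF _ _ tendsto_const tendsto_rabs_zero[OF that]])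
          (auto simp: indicator_def)
      ultimately show ?case by simp
    qed
    show "AE \<omega> in \<P>. norm (?d n \<omega>) \<le> 1" for n
    proof (rule AE_I2)
      fix \<omega> assume \<omega>: "\<omega> \<in> space \<P>"
      have "0 \<le> \<mu> \<omega> (fibre (?An n) \<omega>)" "\<mu> \<omega> (fibre (?An n) \<omega>) \<le> 1"
        using \<omega> An by (auto intro!: bounds)
      then show "norm (?d n \<omega>) \<le> 1"
        using prod[OF \<omega>, of n] by (simp add: abs_le_iff)
    qed
  qed auto
  moreover have "(\<integral>\<omega>. ?d n \<omega> \<partial>\<P>) = measure \<nu> (?An n) - (\<integral>\<omega>. ?\<phi> ((\<sigma> ^^ n) \<omega>) * ?\<psi> \<omega> \<partial>\<P>)" for n
    using \<mu>_fibre_integrable[OF An] prod_int by (simp add: measure_\<nu>[OF An])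
  ultimately have "(\<lambda>n. measure \<nu> (?An n) - (\<integral>\<omega>. ?\<phi> ((\<sigma> ^^ n) \<omega>) * ?\<psi> \<omega> \<partial>\<P>)) \<longlonglongrightarrow> 0"
    by simp
  \<comment> \<open>Mixing of the base is needed here for functions rather than sets: on
    \<open>F\<close>, \<open>?\<phi> \<omega>\<close> is the fibre measure of \<open>E\<close>,
    which varies with \<open>\<omega>\<close>.\<close>
  moreover have "(\<lambda>n. \<integral>\<omega>. ?\<phi> ((\<sigma> ^^ n) \<omega>) * ?\<psi> \<omega> \<partial>\<P>) \<longlonglongrightarrow> measure \<nu> ?A * measure \<nu> B"
    unfolding measure_\<nu>[OF A] measure_\<nu>[OF B]
  proof (rule mixing_integral[OF prob_base base_preserving mix \<mu>_fibre_integrable[OF A]])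
    show "\<bar>?\<psi> \<omega>\<bar> \<le> 1" if "\<omega> \<in> space \<P>" for \<omega>
      using that B by (simp add: bounds)
  qed measurable
  ultimately show ?thesis
    by (rule Lim_transform[rotated])
qed

text \<open>Only the set that is pulled back by the iterates is restricted to rectangles; the
  previous lemma already allows every measurable \<open>B\<close>, so a single Dynkin argument is
  enough.\<close>

lemma mixing_skew_product:
  assumes "mixing \<P> \<sigma>" and "prior_mixing_inhomogeneous \<P> m P \<sigma>"
  shows "mixing \<nu> \<Theta>"
proof (rule mixing_if_generator[OF total.prob_space_axioms skew_product_measure_preserving])
  let ?G = "{F \<times> E | F E. F \<in> sets \<P> \<and> E \<in> sets m}"
  show "Int_stable ?G" by (rule Int_stable_pair_measure_generator)
  show "?G \<subseteq> Pow (space \<nu>)"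
    unfolding space_\<nu> space_pair_measure by (rule pair_measure_closed)
  show "sets \<nu> = sigma_sets (space \<nu>) ?G"
    unfolding sets_\<nu> space_\<nu> sets_pair_measure space_pair_measure ..
  fix A B assume "A \<in> ?G" "B \<in> sets \<nu>"
  then show "(\<lambda>n. measure \<nu> (((\<Theta> ^^ n) -` A \<inter> space \<nu>) \<inter> B)) \<longlonglongrightarrow> measure \<nu> A * measure \<nu> B"
    using rectangle_decorrelation[OF assms] by (auto simp: sets_\<nu>)
qed

end

theorem theorem2p5:
  fixes \<P> :: "'w measure" and m :: "'x measure"
    and \<sigma> :: "'w \<Rightarrow> 'w" and T :: "'w \<Rightarrow> 'x \<Rightarrow> 'x"
    and P :: "'w \<Rightarrow> ('x \<Rightarrow> real) \<Rightarrow> 'x \<Rightarrow> real" and h :: "'w \<Rightarrow> 'x \<Rightarrow> real"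
  assumes "prob_space m" and "prob_space \<P>"
    and "invertible_transformation \<P> \<sigma>" and "measure_preserving \<P> \<sigma>" and "mixing \<P> \<sigma>"
    and "(\<lambda>(\<omega>, x). T \<omega> x) \<in> \<P> \<Otimes>\<^sub>M m \<rightarrow>\<^sub>M m"
    and "AE \<omega> in \<P>. nonsingular m (T \<omega>)"
    and "markov_operator_cocycle \<P> m P"
    and "AE \<omega> in \<P>. perron_frobenius_operator m (T \<omega>) (P \<omega>)"
    and "invariant_density_map \<P> m P \<sigma> h"
    and "prior_mixing_inhomogeneous \<P> m P \<sigma>"
  shows "mixing (skew_measure \<P> m h) (skew_product \<sigma> T)"
proof -
  interpret perron_frobenius_cocycle \<P> m \<sigma> T P h
    by (rule perron_frobenius_cocycle.intro) (fact assms)+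
  show ?thesis
    using assms by (intro mixing_skew_product)
qed

end
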